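(* Let $F$ and $G$ be Souslin spaces equipped with their Borel $\sigma$-algebras $\mathcal F$ and $\mathcal G$, respectively. Let $X$ be an $F$-valued and $Y$ a $G$-valued random variable on a complete probability space $(\Omega,\Sigma,P)$. Let $A\in\mathcal G^{\mu_Y}$ be any subset of the topological support $S$ of $\mu_Y$ such that either $A\subset\overline{A^\circ}$ or $\mu_Y(A)=1$. If $\mu$ is a solution of the statistical inverse problem of estimating the probabilities of $X$ given $Y$ that is $\mathcal F$-continuous on $A$, then for every $y\in A$ the posterior distribution $\mu(\cdot,y)$ is absolutely continuous with respect to the prior distribution $\mu_X$.
   Context: A Souslin space is a Hausdorff topological space that is the image of a complete separable metric space under a continuous mapping. For a random variable $Z$, $\mu_Z=P\circ Z^{-1}$ is its image measure; $\mu_X$ is called the prior distribution. A Borel measure and its Lebesgue completion are denoted by the same symbol. $\mathcal G^{\mu_Y}$ is the completion of $\mathcal G$ with respect to $\mu_Y$, and "$\mu_Y$-measurable" means measurable with respect to $\mathcal G^{\mu_Y}$. A solution of the statistical inverse problem of estimating the distribution (probabilities) of $X$ given $Y$ is a mapping $\mu:\mathcal F\times G\to[0,1]$ such that (1) $\mu(U,Y(\omega))=\mathbf E[1_U(X)\,|\,Y^{-1}(\mathcal G)](\omega)$ $P$-almost surely for every $U\in\mathcal F$; (2) $y\mapsto\mu(U,y)$ is $\mu_Y$-measurable for every $U\in\mathcal F$; (3) $U\mapsto\mu(U,y)$ is a probability measure on $(F,\mathcal F)$ for every $y\in G$. The measures $\mu(\cdot,y)$ are called posterior distributions. A solution $\mu$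 is $\mathcal F$-continuous on $A\subset G$ if $y\mapsto\mu(U,y)$ is continuous on $A$ with respect to the relative topology for every $U\in\mathcal F$. The topological support $S$ of $\mu_Y$ is the smallest closed set $S\subset G$ with $\mu_Y(S)=1$ (it exists on Souslin spaces). $A^\circ$ denotes the interior of $A$ in $G$ and $\overline{A^\circ}$ its closure. *)

theory Defs
  imports "HOL-Probability.Probability"
begin

text \<open>A separable metric space has at most continuum many points, so restricting the carrier of the
  complete separable metric space to subsets of the reals loses no generality; the lemma
  \<open>souslin_spaceI\<close> below confirms this for domains of arbitrary type.\<close>

definition souslin_space :: "'a topology \<Rightarrow> bool" where
  "souslin_space T \<longleftrightarrow> Hausdorff_space T \<and>
     (\<exists>(Z :: real topology) g. completely_metrizable_space Z \<and> separable_space Z \<and>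
        continuous_map Z T g \<and> g ` topspace Z = topspace T)"

lemma second_countable_if_separable_metrizable:
  assumes "metrizable_space Z" "separable_space Z"
  shows "second_countable Z"
proof -
  obtain M d where Md: "Metric_space M d" and Z: "Z = Metric_space.mtopology M d"
    using assms(1) unfolding metrizable_space_def by auto
  interpret Metric_space M d by fact
  obtain C where C: "countable C" "C \<subseteq> M" "mtopology closure_of C = M"
    using assms(2) unfolding separable_space_def Z by auto
  let ?B = "(\<lambda>(c, n). mball c (1 / real (Suc n))) ` (C \<times> UNIV)"
  have "\<exists>V\<in>?B. x \<in> V \<and> V \<subseteq> U" if U: "openin mtopology U" "x \<in> U" for U x
  proof -
    obtain r where r: "r > 0" "mball x r \<subseteq> U"
      using U unfolding openin_mtopology by blast
    have xM: "x \<in> M"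
      using U openin_mtopology by blast
    obtain n where n: "1 / real (Suc n) < r / 2"
      using r(1) by (meson half_gt_zero nat_approx_posE)
    have "x \<in> mtopology closure_of C"
      using xM C(3) by simp
    moreover have "1 / real (Suc n) > 0"
      by simp
    ultimately obtain c where c: "c \<in> C" "c \<in> mball x (1 / real (Suc n))"
      unfolding metric_closure_of by blast
    have cM: "c \<in> M" and dc: "d x c < 1 / real (Suc n)"
      using c(2) by (simp_all add: in_mball)
    have "x \<in> mball c (1 / real (Suc n))"
      using xM cM dc by (simp add: in_mball commute)
    moreover have "mball c (1 / real (Suc n)) \<subseteq> mball x r"
    proof
      fix z assume "z \<in> mball c (1 / real (Suc n))"
      then have "z \<in> M" "d c z < 1 / real (Suc n)"
        by (simp_all add: in_mball)
      then show "z \<in> mball x r"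
        using triangle[OF xM cM, of z] dc n xM by (simp add: in_mball)
    qed
    ultimately show ?thesis
      using c(1) r(2) by force
  qed
  moreover have "countable ?B"
    using C(1) by simp
  ultimately show ?thesis
    unfolding second_countable_def Z by (intro exI[of _ ?B]) auto
qed

lemma second_countable_lepoll_real:
  assumes "second_countable Z" "Hausdorff_space Z"
  shows "topspace Z \<lesssim> (UNIV :: real set)"
proof -
  obtain B where B: "countable B" "\<forall>V\<in>B. openin Z V"
    "\<forall>U x. openin Z U \<and> x \<in> U \<longrightarrow> (\<exists>V\<in>B. x \<in> V \<and> V \<subseteq> U)"
    using assms(1) unfolding second_countable_def by (elim exE conjE) (rule that)
  define f where "f x = to_nat_on B ` {V \<in> B. x \<in> V}" for x
  have "inj_on f (topspace Z)"
  proof (rule inj_onI, rule ccontr)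
    fix x y assume xy: "x \<in> topspace Z" "y \<in> topspace Z" "f x = f y" "x \<noteq> y"
    then obtain U U' where U: "openin Z U" "x \<in> U" "y \<in> U'" "disjnt U U'"
      using assms(2) unfolding Hausdorff_space_def by metis
    then have "y \<notin> U"
      by (auto simp: disjnt_iff)
    moreover obtain V where "V \<in> B" "x \<in> V" "V \<subseteq> U"
      using B(3) U(1,2) by metis
    ultimately have V: "V \<in> B" "x \<in> V" "y \<notin> V"
      by auto
    then have "to_nat_on B V \<in> f y"
      using xy(3) unfolding f_def by auto
    then obtain V' where "V' \<in> B" "y \<in> V'" "to_nat_on B V = to_nat_on B V'"
      unfolding f_def by auto
    then show False
      using V inj_on_to_nat_on[OF B(1)] by (metis inj_onD)
  qed
  then have "topspace Z \<lesssim> (UNIV :: nat set set)"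
    unfolding lepoll_def by blast
  then show ?thesis
    using nat_sets_eqpoll_reals lepoll_trans2 by blast
qed

lemma souslin_spaceI:
  fixes Z :: "'b topology"
  assumes T: "Hausdorff_space T"
    and Z: "completely_metrizable_space Z" "separable_space Z"
    and g: "continuous_map Z T g" "g ` topspace Z = topspace T"
  shows "souslin_space T"
proof -
  have met: "metrizable_space Z"
    using Z(1) by (rule completely_metrizable_imp_metrizable_space)
  then have "second_countable Z"
    using Z(2) by (rule second_countable_if_separable_metrizable)
  then have "topspace Z \<lesssim> (UNIV :: real set)"
    using met by (intro second_countable_lepoll_real metrizable_imp_Hausdorff_space)
  then obtain h :: "'b \<Rightarrow> real" where h: "inj_on h (topspace Z)"
    unfolding lepoll_def by blast
  define k where "k = inv_into (topspace Z) h"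
  define W where "W = pullback_topology (h ` topspace Z) k Z"
  have kh: "k (h x) = x" if "x \<in> topspace Z" for x
    using that h by (simp add: k_def)
  have tW: "topspace W = h ` topspace Z"
    using kh by (auto simp: W_def topspace_pullback_topology)
  have "continuous_map W Z (id \<circ> k)"
    unfolding W_def by (rule continuous_map_pullback) simp
  then have kc: "continuous_map W Z k"
    by simp
  have hc: "continuous_map Z W h"
    unfolding W_def
  proof (rule continuous_map_pullback')
    show "continuous_map Z Z (k \<circ> h)"
      by (rule continuous_map_eq[of Z Z id]) (simp_all add: kh)
  qed auto
  have "homeomorphic_maps Z W h k"
    using kc hc kh tW by (auto simp: homeomorphic_maps_def)
  then have hom: "Z homeomorphic_space W"
    unfolding homeomorphic_space_def by blast
  have "continuous_map W T (g \<circ> k)"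
    using kc g(1) by (rule continuous_map_compose)
  moreover have "(g \<circ> k) ` topspace W = topspace T"
    using kh g(2) by (force simp: tW image_image)
  ultimately show ?thesis
    using T Z hom homeomorphic_completely_metrizable_space homeomorphic_separable_space
    unfolding souslin_space_def by blast
qed

definition topological_support :: "'a::topological_space measure \<Rightarrow> 'a set" where
  "topological_support N = (LEAST S. closed S \<and> emeasure N S = 1)"

text \<open>On a Souslin space the smallest closed set of full measure exists:\<close>

lemma topological_support:
  fixes N :: "'a::topological_space measure"
  assumes T: "souslin_space (euclidean :: 'a topology)"
    and N: "prob_space N" "sets N = sets borel"
  shows "closed (topological_support N)" "emeasure N (topological_support N) = 1"
    and "\<And>C. closed C \<Longrightarrow> emeasure N C = 1 \<Longrightarrow> topological_support N \<subseteq> C"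
proof -
  interpret prob_space N by fact
  have sp: "space N = UNIV" 
    using sets_eq_imp_space_eq[OF N(2)] by simp
  have compl: "emeasure N C = 1 \<longleftrightarrow> emeasure N (- C) = 0" if "closed C" for C
  proof -
    have C: "C \<in> events" using that N(2) by simp
    have "prob (- C) = 1 - prob C"
      using prob_compl[OF C] by (simp add: sp Compl_eq_Diff_UNIV)
    then show ?thesis
      by (simp add: emeasure_eq_measure)
  qed
  define \<U> where "\<U> = {- C | C :: 'a set. closed C \<and> emeasure N C = 1}"
  have \<U>: "open U" "emeasure N U = 0" if "U \<in> \<U>" for U
    using that compl unfolding \<U>_def by auto
  obtain Z :: "real topology" and g where Z: "completely_metrizable_space Z" "separable_space Z"
    "continuous_map Z (euclidean :: 'a topology) g" "g ` topspace Z = UNIV"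
    using T unfolding souslin_space_def by auto
  have sc: "second_countable Z"
    using Z by (simp add: completely_metrizable_imp_metrizable_space
        second_countable_if_separable_metrizable)
  have pre: "openin Z {x \<in> topspace Z. g x \<in> U}" if "open U" for U
    using that Z(3) by (simp add: openin_continuous_map_preimage)
  obtain B where B: "countable B" "\<forall>V\<in>B. openin Z V"
    "\<forall>U x. openin Z U \<and> x \<in> U \<longrightarrow> (\<exists>V\<in>B. x \<in> V \<and> V \<subseteq> U)"
    using sc unfolding second_countable_def by (elim exE conjE) (rule that)
  define B' where "B' = {V\<in>B. \<exists>U\<in>\<U>. g ` V \<subseteq> U}"
  define c where "c V = (SOME U. U \<in> \<U> \<and> g ` V \<subseteq> U)" for V
  have c: "c V \<in> \<U>" "g ` V \<subseteq> c V" if "V \<in> B'" for V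
    using someI_ex[of "\<lambda>U. U \<in> \<U> \<and> g ` V \<subseteq> U"] that unfolding B'_def c_def by auto
  have eq: "\<Union>\<U> = (\<Union>V\<in>B'. c V)"
  proof (intro equalityI subsetI)
    fix y assume "y \<in> \<Union>\<U>"
    then obtain U x where U: "U \<in> \<U>" "y \<in> U" "x \<in> topspace Z" "g x = y"
      using Z(4) by (metis UNIV_I UnionE imageE)
    then obtain V where "V \<in> B" "x \<in> V" "V \<subseteq> {x \<in> topspace Z. g x \<in> U}"
      using B(3) pre[OF \<U>(1)[OF U(1)]] by blast
    then show "y \<in> (\<Union>V\<in>B'. c V)"
      using U c(2)[of V] unfolding B'_def by blast
  qed (use c(1) in blast)
  have "c V \<in> null_sets N" if "V \<in> B'" for V
    using \<U>[OF c(1)[OF that]] N(2) by (simp add: null_sets_def)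
  moreover have "countable B'"
    using B(1) by (simp add: B'_def)
  ultimately have "(\<Union>V\<in>B'. c V) \<in> null_sets N"
    by (intro null_sets_UN')
  then have nul: "emeasure N (\<Union>\<U>) = 0"
    unfolding eq by auto
  let ?S = "- \<Union>\<U>"
  have cl: "closed ?S"
    using \<U>(1) by (simp add: closed_def open_Union)
  have one: "emeasure N ?S = 1"
    using compl[OF cl] nul by simp
  have least: "?S \<subseteq> C" if "closed C" "emeasure N C = 1" for C
    using that unfolding \<U>_def by blast
  have "topological_support N = ?S"
    unfolding topological_support_def using cl one least by (intro Least_equality) auto
  with cl one least show "closed (topological_support N)" "emeasure N (topological_support N) = 1"
    "\<And>C. closed C \<Longrightarrow> emeasure N C = 1 \<Longrightarrow> topological_support N \<subseteq> C"
    by auto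
qed

text \<open>\<open>\<mu> U y\<close> is the posterior probability of \<open>U\<close> given \<open>Y = y\<close>. Only the values at Borel sets \<open>U\<close>
  matter.\<close>

definition sip_solution ::
  "'w measure \<Rightarrow> ('w \<Rightarrow> 'f::topological_space) \<Rightarrow> ('w \<Rightarrow> 'g::topological_space) \<Rightarrow>
    ('f set \<Rightarrow> 'g \<Rightarrow> real) \<Rightarrow> bool" where
  "sip_solution P X Y \<mu> \<longleftrightarrow>
     (\<forall>U\<in>sets borel. \<forall>y. 0 \<le> \<mu> U y \<and> \<mu> U y \<le> 1) \<and>
     (\<forall>U\<in>sets borel. AE \<omega> in P.
        \<mu> U (Y \<omega>) =
          real_cond_exp P (vimage_algebra (space P) Y borel) (\<lambda>\<omega>'. indicator U (X \<omega>')) \<omega>) \<and>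
     (\<forall>U\<in>sets borel. \<mu> U \<in> borel_measurable (completion (distr P borel Y))) \<and>
     (\<forall>y. measure_space UNIV (sets borel) (\<lambda>U. ennreal (\<mu> U y)) \<and> \<mu> UNIV y = 1)"

definition posterior :: "('f::topological_space set \<Rightarrow> 'g \<Rightarrow> real) \<Rightarrow> 'g \<Rightarrow> 'f measure" where
  "posterior \<mu> y = measure_of UNIV (sets borel) (\<lambda>U. ennreal (\<mu> U y))"

lemma posterior:
  fixes \<mu> :: "'f::topological_space set \<Rightarrow> 'g::topological_space \<Rightarrow> real"
  assumes "sip_solution P X Y \<mu>"
  shows "prob_space (posterior \<mu> y)" "sets (posterior \<mu> y) = sets borel"
    and "U \<in> sets borel \<Longrightarrow> emeasure (posterior \<mu> y) U = ennreal (\<mu> U y)"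
proof -
  have ms: "measure_space UNIV (sets borel) (\<lambda>U. ennreal (\<mu> U y))" and one: "\<mu> UNIV y = 1"
    using assms by (simp_all add: sip_solution_def)
  have sa: "sigma_algebra UNIV (sets (borel :: 'f measure))"
    using ms by (simp add: measure_space_def)
  show sets: "sets (posterior \<mu> y) = sets borel"
    unfolding posterior_def by (simp add: sigma_algebra.sets_measure_of_eq[OF sa])
  have sp: "space (posterior \<mu> y) = UNIV"
    unfolding posterior_def by (simp add: space_measure_of_conv)
  have em: "emeasure (posterior \<mu> y) U = ennreal (\<mu> U y)" if "U \<in> sets borel" for U
    unfolding posterior_def using ms that sa
    by (intro emeasure_measure_of_sigma) (auto simp: measure_space_def)
  then show "U \<in> sets borel \<Longrightarrow> emeasure (posterior \<mu> y) U = ennreal (\<mu> U y)" .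
  show "prob_space (posterior \<mu> y)"
    by (rule prob_spaceI) (simp add: sp em one)
qed

end

theory Submission
  imports Defs
begin

text \<open>If \<open>U\<close> is a null set of the prior, then the conditional expectation of \<open>1\<^sub>U(X)\<close> vanishes almost
  surely, so the set where \<open>\<mu> U\<close> is positive is a null set of the law of \<open>Y\<close>. By continuity, positivity
  at a point \<open>y\<close> of \<open>A\<close> would persist on the trace on \<open>A\<close> of an open neighbourhood \<open>V\<close> of \<open>y\<close>. Hence
  either \<open>V\<close> (if \<open>A\<close> has full measure) or \<open>V \<inter> interior A\<close> (if \<open>y\<close> adheres to the interior) is a nonempty
  open null set meeting the support, which is impossible.\<close>

text \<open>The complement of \<open>V\<close> is closed and has full measure, so it contains the
  support by minimality. The Souslin hypothesis guarantees that a least such closed set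
  exists.\<close>

lemma topological_support_Int_open_null:
  fixes N :: "'a::topological_space measure"
  assumes "souslin_space (euclidean :: 'a topology)"
    and "prob_space N" and sets_N: "sets N = sets borel"
    and "open V" and null: "emeasure N V = 0"
  shows "topological_support N \<inter> V = {}"
proof -
  interpret prob_space N by fact
  have V: "V \<in> sets N"
    using \<open>open V\<close> sets_N by simp
  have "space N = UNIV"
    using sets_eq_imp_space_eq[OF sets_N] by simp
  then have "prob (- V) = 1"
    using prob_compl[OF V] null by (simp add: measure_def Compl_eq_Diff_UNIV)
  then have "topological_support N \<subseteq> - V"
    using \<open>open V\<close> assms(1-3) by (intro topological_support(3)) (auto simp: emeasure_eq_measure)
  then show ?thesis
    by auto
qed

lemma (in sigma_finite_subalgebra) real_cond_exp_AE_zero: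
  assumes f: "AE x in M. f x = 0" "f \<in> borel_measurable M"
  shows "AE x in M. real_cond_exp M F f x = 0"
proof -
  have "AE x in M. real_cond_exp M F f x = real_cond_exp M F (\<lambda>x. 0) x"
    by (intro real_cond_exp_cong) (use f in auto)
  moreover have "AE x in M. real_cond_exp M F (\<lambda>x. 0) x = 0"
    by (intro real_cond_exp_F_meas) auto
  ultimately show ?thesis
    by eventually_elim simp
qed

lemma sip_solution_AE_zero:
  assumes "prob_space P" and X: "X \<in> measurable P borel" and Y: "Y \<in> measurable P borel"
    and sol: "sip_solution P X Y \<mu>"
    and U: "U \<in> null_sets (distr P borel X)"
  shows "AE \<omega> in P. \<mu> U (Y \<omega>) = 0"
proof -
  interpret prob_space P by fact
  have [measurable]: "U \<in> sets borel"
    using U by (auto simp: null_sets_def)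
  note [measurable] = X
  \<comment> \<open>Measurability of \<open>Y\<close> makes the \<sigma>-algebra generated by
    \<open>Y\<close> a subalgebra of \<open>P\<close>, so conditional expectations given
    \<open>Y\<close> are available.\<close>
  interpret finite_measure_subalgebra P "vimage_algebra (space P) Y borel"
    by unfold_locales (use measurable_sets[OF Y] in \<open>auto simp: subalgebra_def sets_vimage_algebra2\<close>)
  have "AE \<omega> in P. X \<omega> \<notin> U"
    using AE_not_in[OF U] by (simp add: AE_distr_iff)
  then have "AE \<omega> in P. indicator U (X \<omega>) = (0 :: real)"
    by eventually_elim simp
  then have "AE \<omega> in P. real_cond_exp P (vimage_algebra (space P) Y borel)
      (\<lambda>\<omega>'. indicator U (X \<omega>')) \<omega> = 0"
    by (intro real_cond_exp_AE_zero) measurable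
  moreover have "AE \<omega> in P. \<mu> U (Y \<omega>) =
      real_cond_exp P (vimage_algebra (space P) Y borel) (\<lambda>\<omega>'. indicator U (X \<omega>')) \<omega>"
    using sol \<open>U \<in> sets borel\<close> by (simp add: sip_solution_def)
  ultimately show ?thesis
    by auto
qed

text \<open>Since \<open>B\<close> need only be measurable for the completion, the image measure
  formula is applied to its main part: an \<open>N\<close>-measurable subset of \<open>B\<close>
  that carries the whole completed measure of \<open>B\<close>.\<close>

lemma null_sets_completion_distrI:
  assumes f: "f \<in> measurable M N"
    and B: "B \<in> sets (completion (distr M N f))" and AE: "AE x in M. f x \<notin> B"
  shows "B \<in> null_sets (completion (distr M N f))"
proof -
  let ?D = "distr M N f"
  have E: "main_part ?D B \<in> sets N" "main_part ?D B \<subseteq> B"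
    using main_part_sets[OF B] main_part_null_part_Un[OF B] by auto
  have "AE x in M. f x \<notin> main_part ?D B"
    using AE by eventually_elim (use E(2) in auto)
  then have "AE y in ?D. y \<notin> main_part ?D B"
    using E(1) f by (subst AE_distr_iff) auto
  then have "emeasure ?D (main_part ?D B) = 0"
    using E(1) by (subst (asm) AE_iff_null_sets[symmetric]) auto
  then show ?thesis
    using B by (simp add: null_sets_def)
qed

theorem theorem2p8:
  fixes P :: "'w measure"
    and X :: "'w \<Rightarrow> 'f::topological_space"
    and Y :: "'w \<Rightarrow> 'g::topological_space"
    and A :: "'g set"
    and \<mu> :: "'f set \<Rightarrow> 'g \<Rightarrow> real"
  assumes "souslin_space (euclidean :: 'f topology)"
    and "souslin_space (euclidean :: 'g topology)"
    and "prob_space P" and "complete_measure P"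
    and "X \<in> measurable P borel" and "Y \<in> measurable P borel"
    and "A \<in> sets (completion (distr P borel Y))"
    and "A \<subseteq> topological_support (distr P borel Y)"
    and "A \<subseteq> closure (interior A) \<or> emeasure (completion (distr P borel Y)) A = 1"
    and "sip_solution P X Y \<mu>"
    and "\<forall>U\<in>sets borel. continuous_on A (\<lambda>y. \<mu> U y)"
  shows "\<forall>y\<in>A. absolutely_continuous (distr P borel X) (posterior \<mu> y)"
proof (intro ballI)
  interpret prob_space P by fact
  let ?D = "distr P borel Y"
  note sol = \<open>sip_solution P X Y \<mu>\<close>
  have D: "prob_space ?D"
    using \<open>Y \<in> measurable P borel\<close> by (rule prob_space_distr)
  fix y assume "y \<in> A"
  show "absolutely_continuous (distr P borel X) (posterior \<mu> y)"
    unfolding absolutely_continuous_def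
  proof
    fix U assume U: "U \<in> null_sets (distr P borel X)"
    then have U_borel: "U \<in> sets borel"
      by (auto simp: null_sets_def)
    have "\<mu> U y = 0"
    proof (rule ccontr)
      assume "\<mu> U y \<noteq> 0"
      then have "y \<in> A \<inter> \<mu> U -` (- {0})"
        using \<open>y \<in> A\<close> by simp
      moreover have "continuous_on A (\<mu> U)"
        using assms(11) U_borel by blast
      \<comment> \<open>The set where \<open>\<mu> U\<close> is nonzero is open only relative to
        \<open>A\<close>; \<open>V\<close> is an open set of the whole space with that trace on
        \<open>A\<close>.\<close>
      then obtain V where "open V" and V: "V \<inter> A = \<mu> U -` (- {0}) \<inter> A"
        unfolding continuous_on_open_invariant by (meson open_Compl closed_singleton)
      ultimately have "y \<in> V"
        by auto
      have "V \<in> sets (completion ?D)"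
        using \<open>open V\<close> by (intro sets_completionI_sets) simp
      then have VA_sets: "V \<inter> A \<in> sets (completion ?D)"
        using assms(7) by (rule sets.Int)
      have "AE \<omega> in P. \<mu> U (Y \<omega>) = 0"
        using assms(3,5,6) sol U by (rule sip_solution_AE_zero)
      then have "AE \<omega> in P. Y \<omega> \<notin> V \<inter> A"
        by eventually_elim (simp add: V)
      then have VA: "V \<inter> A \<in> null_sets (completion ?D)"
        using assms(6) VA_sets by (intro null_sets_completion_distrI)
      \<comment> \<open>Both alternatives for \<open>A\<close> lead to such a \<open>W\<close>,
        which contradicts the inclusion of \<open>A\<close> in the support.\<close>
      from assms(9) have "\<exists>W. open W \<and> emeasure ?D W = 0 \<and> W \<inter> A \<noteq> {}"
      proof
        assume "A \<subseteq> closure (interior A)"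
        then have "V \<inter> interior A \<noteq> {}"
          using \<open>y \<in> A\<close> \<open>y \<in> V\<close> open_Int_closure_eq_empty[OF \<open>open V\<close>] by blast
        moreover have "open (V \<inter> interior A)"
          using \<open>open V\<close> by auto
        \<comment> \<open>This is a subset of the null set \<open>V \<inter> A\<close>; being open,
          it is also null for \<open>?D\<close> itself.\<close>
        moreover have "V \<inter> interior A \<in> null_sets (completion ?D)"
          using \<open>open V\<close> interior_subset[of A]
          by (intro null_sets_subset[OF VA]) (auto intro!: sets_completionI_sets)
        then have "emeasure ?D (V \<inter> interior A) = 0"
          using \<open>open V\<close> by (simp add: null_sets_def)
        ultimately show ?thesis
          using interior_subset[of A] by blast
      next
        assume "emeasure (completion ?D) A = 1"
        then have "AE z in completion ?D. z \<in> A"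
          using assms(7) prob_space.AE_in_set_eq_1[OF prob_space.prob_space_completion[OF D]]
          by (simp add: measure_def)
        moreover have "AE z in completion ?D. z \<notin> V \<inter> A"
          using VA by (rule AE_not_in)
        \<comment> \<open>Almost every point lies in \<open>A\<close> but outside
          \<open>V \<inter> A\<close>, so all of \<open>V\<close> is null and serves as
          \<open>W\<close>.\<close>
        ultimately have "AE z in completion ?D. z \<notin> V"
          by eventually_elim auto
        then have "emeasure (completion ?D) V = 0"
          using \<open>V \<in> sets (completion ?D)\<close>
          by (subst (asm) AE_iff_null_sets[symmetric]) auto
        then have "emeasure ?D V = 0"
          using \<open>open V\<close> by simp
        then show ?thesis
          using \<open>open V\<close> \<open>y \<in> V\<close> \<open>y \<in> A\<close> by blast
      qed
      then obtain W where "open W" "emeasure ?D W = 0" "W \<inter> A \<noteq> {}"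
        by blast
      then show False
        using topological_support_Int_open_null[OF assms(2) D, of W] assms(8) by auto
    qed
    then show "U \<in> null_sets (posterior \<mu> y)"
      using U_borel posterior[OF sol] by (simp add: null_sets_def)
  qed
qed

end
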